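(* Let $D$ be an open neighbourhood of $\mathbb{R}^n_+$ and let $f,g:D\to\mathbb{R}^n$ be $C^1$ maps such that $(f+g)(0)=0$, $g(x)\geq 0$ for all $x\in\mathbb{R}^n_+$, and $f_i(x)\geq 0$ for all $i$ and all $x\in\mathbb{R}^n_+$ with $x_i=0$. Suppose that $f$ and $g$ are subhomogeneous of degree $\alpha>0$. Assume that for every $w\in\mathbb{R}^n_+\setminus\{0\}$ there is some index $i\in\{1,\dots,n\}$ such that $$\sup\{g_i(y): 0\leq y\leq w\} < -\sup\{f_i(x): 0\leq x\leq w,\ x_i=w_i\}.$$ Then for every $\tau\geq 0$, the origin is a globally asymptotically stable equilibrium of the time-delay system $$\dot{x}(t)=f(x(t))+g(x(t-\tau))$$ on the state space $C([-\tau,0],\mathbb{R}^n_+)$.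
   Context: $\mathbb{R}^n_+$ is the nonnegative orthant. For $x,y\in\mathbb{R}^n$, $x\geq y$ means $x_i\geq y_i$ for all $i$. A map $f$ is subhomogeneous of degree $\alpha>0$ if $f(\lambda x)\leq \lambda^\alpha f(x)$ for all $\lambda\geq 1$ and all $x\in\mathbb{R}^n_+$ (componentwise inequality). Under the stated sign conditions on $f$ and $g$ the delay system is positive: for initial conditions $\phi\in C([-\tau,0],\mathbb{R}^n_+)$ the solution $x(t,\phi)$ stays in $\mathbb{R}^n_+$. Global asymptotic stability of the origin means it is Lyapunov stable and every solution with initial condition in $C([-\tau,0],\mathbb{R}^n_+)$ converges to $0$ as $t\to\infty$. *)

theory Defs
  imports "HOL-Analysis.Analysis"
begin

definition nonneg_orthant :: "(real ^ 'n) set" where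
  "nonneg_orthant = {x. \<forall>i. 0 \<le> x $ i}"

definition C1_on :: "(real ^ 'n) set \<Rightarrow> (real ^ 'n \<Rightarrow> real ^ 'm) \<Rightarrow> bool" where
  "C1_on D f \<longleftrightarrow> (\<exists>f'. (\<forall>x\<in>D. (f has_derivative blinfun_apply (f' x)) (at x))
                       \<and> continuous_on D f')"

definition subhomogeneous :: "real \<Rightarrow> (real ^ 'n \<Rightarrow> real ^ 'n) \<Rightarrow> bool" where
  "subhomogeneous \<alpha> f \<longleftrightarrow>
     (\<forall>c::real. \<forall>x\<in>nonneg_orthant. c \<ge> 1 \<longrightarrow> f (c *\<^sub>R x) \<le> (c powr \<alpha>) *\<^sub>R f x)"

definition init_space :: "real \<Rightarrow> (real \<Rightarrow> real ^ 'n) set" where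
  "init_space \<tau> = {\<phi>. continuous_on {-\<tau>..0} \<phi> \<and> (\<forall>s\<in>{-\<tau>..0}. \<phi> s \<in> nonneg_orthant)}"

definition dde_solution ::
  "(real ^ 'n \<Rightarrow> real ^ 'n) \<Rightarrow> (real ^ 'n \<Rightarrow> real ^ 'n) \<Rightarrow> real \<Rightarrow>
   (real \<Rightarrow> real ^ 'n) \<Rightarrow> (real \<Rightarrow> real ^ 'n) \<Rightarrow> bool" where
  "dde_solution f g \<tau> \<phi> x \<longleftrightarrow>
     (\<forall>s\<in>{-\<tau>..0}. x s = \<phi> s) \<and>
     (\<forall>t\<ge>0. (x has_vector_derivative (f (x t) + g (x (t - \<tau>)))) (at t within {0..}))"

definition dde_GAS ::
  "(real ^ 'n \<Rightarrow> real ^ 'n) \<Rightarrow> (real ^ 'n \<Rightarrow> real ^ 'n) \<Rightarrow> real \<Rightarrow> bool" where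
  "dde_GAS f g \<tau> \<longleftrightarrow>
     (\<forall>\<phi>\<in>init_space \<tau>. \<exists>x. dde_solution f g \<tau> \<phi> x) \<and>
     (\<forall>\<epsilon>>0. \<exists>\<delta>>0. \<forall>\<phi>\<in>init_space \<tau>. \<forall>x.
         (\<forall>s\<in>{-\<tau>..0}. norm (\<phi> s) < \<delta>) \<and> dde_solution f g \<tau> \<phi> x
         \<longrightarrow> (\<forall>t\<ge>0. norm (x t) < \<epsilon>)) \<and>
     (\<forall>\<phi>\<in>init_space \<tau>. \<forall>x. dde_solution f g \<tau> \<phi> x \<longrightarrow> (x \<longlongrightarrow> 0) at_top)"

end

theory Submission
  imports Defs
begin

text \<open>
  Let \<open>h i w\<close> be the sum of the two suprema in the hypothesis, so that for every nonzero
  \<open>w\<close> in the orthant some \<open>h i w\<close> is negative. Brouwer's theorem on a simplex turns this into a single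
  point \<open>v\<close> with positive coordinates at which all \<open>h i v\<close> are negative, and this point can be chosen on
  the simplex of any size. Each box \<open>{0..v}\<close> is then invariant, because on its upper face
  \<open>x i = v i\<close> the derivative of \<open>x i\<close> is at most \<open>h i v < 0\<close>; small simplices give Lyapunov stability.
  By subhomogeneity \<open>{0..c v}\<close> is invariant for all \<open>c \<ge> 1\<close>, so every solution is bounded. Finally,
  let \<open>w\<close> be the componentwise limit superior of a solution. If \<open>w \<noteq> 0\<close>, then \<open>h i w < 0\<close> for some
  \<open>i\<close>, and by continuity of \<open>h\<close> the component \<open>x i\<close> decreases at a uniform rate whenever it is close to
  \<open>w i\<close> at a large time, a contradiction.

  Existence comes from the system obtained by clamping the arguments of \<open>f\<close> and \<open>g\<close> to an
  invariant box, which is globally Lipschitz and bounded. Arbitrary solutions stay in the box because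
  they coincide with the clamped one by local uniqueness.
\<close>

subsection \<open>Suprema over boxes and their faces\<close>

definition face_sup :: "(real ^ 'n \<Rightarrow> real ^ 'n) \<Rightarrow> 'n \<Rightarrow> real ^ 'n \<Rightarrow> real" where
  "face_sup f i w = Sup ((\<lambda>x. f x $ i) ` {x. 0 \<le> x \<and> x \<le> w \<and> x $ i = w $ i})"

definition box_sup :: "(real ^ 'n \<Rightarrow> real ^ 'n) \<Rightarrow> 'n \<Rightarrow> real ^ 'n \<Rightarrow> real" where
  "box_sup g i w = Sup ((\<lambda>y. g y $ i) ` {y. 0 \<le> y \<and> y \<le> w})"

lemma nonneg_orthant_eq: "nonneg_orthant = {x::real^'n. 0 \<le> x}"
  by (auto simp: nonneg_orthant_def less_eq_vec_def)

lemma bdd_above_component_image: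
  fixes f :: "real ^ 'n \<Rightarrow> real ^ 'n"
  assumes f: "continuous_on nonneg_orthant f" and S: "S \<subseteq> {0..w}"
  shows "bdd_above ((\<lambda>x. f x $ i) ` S)"
proof -
  have "continuous_on {0..w} (\<lambda>x. f x $ i)"
    by (intro continuous_intros continuous_on_subset[OF f]) (auto simp: nonneg_orthant_eq)
  then have "bounded ((\<lambda>x. f x $ i) ` {0..w})"
    by (intro compact_imp_bounded compact_continuous_image compact_interval)
  then show ?thesis
    using S bounded_imp_bdd_above bdd_above_mono image_mono by metis
qed

text \<open>By \<open>near\<close>, \<open>S\<close> is nonexpansive in the Hausdorff distance, so
  uniform continuity of \<open>q\<close> on a compact box carries over to the suprema.\<close>

lemma continuous_on_Sup_image:
  fixes q :: "real ^ 'n \<Rightarrow> real" and S :: "real ^ 'n \<Rightarrow> (real ^ 'n) set"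
  assumes q: "continuous_on nonneg_orthant q"
    and sub: "\<And>w. 0 \<le> w \<Longrightarrow> S w \<subseteq> {0..w}"
    and ne: "\<And>w. 0 \<le> w \<Longrightarrow> S w \<noteq> {}"
    and near: "\<And>v w x. 0 \<le> v \<Longrightarrow> 0 \<le> w \<Longrightarrow> x \<in> S v \<Longrightarrow> \<exists>y\<in>S w. dist x y \<le> dist v w"
  shows "continuous_on nonneg_orthant (\<lambda>w. Sup (q ` S w))"
  unfolding continuous_on_iff
proof (intro ballI allI impI)
  fix w :: "real ^ 'n" and e :: real
  assume w: "w \<in> nonneg_orthant" and e: "0 < e"
  \<comment> \<open>One compact box containing \<open>S v\<close> for all parameters
    \<open>v\<close> within distance 1 of \<open>w\<close>; hence the \<open>min d 1\<close>
    below.\<close>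
  define K where "K = {0..w + 1}"
  have "continuous_on K q"
    by (rule continuous_on_subset[OF q]) (auto simp: K_def nonneg_orthant_eq)
  then have uc: "uniformly_continuous_on K q" and bd: "bdd_above (q ` K)"
    using compact_uniformly_continuous[of K q] compact_continuous_image[of K q]
    by (auto simp: K_def compact_interval compact_imp_bounded bounded_imp_bdd_above)
  then obtain d where d: "d > 0" "\<And>x y. x \<in> K \<Longrightarrow> y \<in> K \<Longrightarrow> dist y x < d \<Longrightarrow> dist (q y) (q x) < e / 2"
    using e unfolding uniformly_continuous_on_def by (metis half_gt_zero)
  have le: "Sup (q ` S a) \<le> Sup (q ` S b) + e / 2"
    if ab: "0 \<le> a" "0 \<le> b" "a \<le> w + 1" "b \<le> w + 1" "dist a b < d" for a b
  proof (rule cSup_least)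
    show "q ` S a \<noteq> {}" using ne that by auto
  next
    fix r assume "r \<in> q ` S a"
    then obtain x where x: "x \<in> S a" "r = q x" by auto
    obtain y where y: "y \<in> S b" "dist x y \<le> dist a b" using near[OF ab(1,2) x(1)] by blast
    have "S a \<subseteq> K" and Sb: "S b \<subseteq> K"
      using order_trans[OF sub[OF ab(1)], of K] order_trans[OF sub[OF ab(2)], of K] ab(3,4)
      by (auto simp: K_def)
    with x y have "x \<in> K" "y \<in> K" by auto
    then have "dist (q x) (q y) < e / 2" using d(2) y(2) ab(5) by auto
    moreover have "q y \<le> Sup (q ` S b)"
      using y Sb bd by (intro cSup_upper bdd_above_mono[OF bd]) auto
    ultimately show "r \<le> Sup (q ` S b) + e / 2" using x unfolding dist_real_def by linarith
  qed
  show "\<exists>d>0. \<forall>x'\<in>nonneg_orthant. dist x' w < d \<longrightarrow> dist (Sup (q ` S x')) (Sup (q ` S w)) < e"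
  proof (intro exI[of _ "min d 1"] conjI ballI impI)
    show "min d 1 > 0" using d by auto
  next
    fix v assume v: "v \<in> nonneg_orthant" "dist v w < min d 1"
    have "v \<le> w + 1"
    proof -
      have "v $ i \<le> w $ i + 1" for i
        using component_le_norm_cart[of "v - w" i] v(2) by (auto simp: dist_norm)
      then show ?thesis by (auto simp: less_eq_vec_def)
    qed
    moreover have "w \<le> w + 1" by (simp add: less_eq_vec_def)
    ultimately have "Sup (q ` S v) \<le> Sup (q ` S w) + e / 2" "Sup (q ` S w) \<le> Sup (q ` S v) + e / 2"
      using v w le[of v w] le[of w v] by (auto simp: nonneg_orthant_eq dist_commute)
    then show "dist (Sup (q ` S v)) (Sup (q ` S w)) < e" using e by (auto simp: dist_real_def)
  qed
qed

lemma dist_le_componentwise: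
  fixes x y v w :: "real ^ 'n"
  assumes "\<And>i. \<bar>x $ i - y $ i\<bar> \<le> \<bar>v $ i - w $ i\<bar>"
  shows "dist x y \<le> dist v w"
  unfolding dist_norm by (rule norm_le_componentwise_cart) (use assms in auto)

lemma continuous_on_face_sup:
  fixes f :: "real ^ 'n \<Rightarrow> real ^ 'n"
  assumes "continuous_on nonneg_orthant f"
  shows "continuous_on nonneg_orthant (face_sup f i)"
  unfolding face_sup_def
proof (rule continuous_on_Sup_image)
  show "continuous_on nonneg_orthant (\<lambda>x. f x $ i)" using assms by (intro continuous_intros)
next
  fix v w x :: "real ^ 'n"
  assume *: "0 \<le> v" "0 \<le> w" "x \<in> {x. 0 \<le> x \<and> x \<le> v \<and> x $ i = v $ i}"
  \<comment> \<open>Truncating \<open>x\<close> to the box of \<open>w\<close> and moving coordinate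
    \<open>i\<close> onto the new face changes coordinate \<open>j\<close> by at most
    \<open>\<bar>v $ j - w $ j\<bar>\<close>.\<close>
  define y where "y = (\<chi> j. if j = i then w $ i else min (x $ j) (w $ j))"
  have "dist x y \<le> dist v w"
    by (rule dist_le_componentwise) (use * in \<open>auto simp: y_def min_def abs_if less_eq_vec_def; smt\<close>)
  moreover have "y \<in> {x. 0 \<le> x \<and> x \<le> w \<and> x $ i = w $ i}"
    using * by (auto simp: y_def less_eq_vec_def)
  ultimately show "\<exists>y\<in>{x. 0 \<le> x \<and> x \<le> w \<and> x $ i = w $ i}. dist x y \<le> dist v w" by blast
qed auto

lemma continuous_on_box_sup:
  fixes g :: "real ^ 'n \<Rightarrow> real ^ 'n"
  assumes "continuous_on nonneg_orthant g"
  shows "continuous_on nonneg_orthant (box_sup g i)"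
  unfolding box_sup_def
proof (rule continuous_on_Sup_image)
  show "continuous_on nonneg_orthant (\<lambda>x. g x $ i)" using assms by (intro continuous_intros)
next
  fix v w x :: "real ^ 'n"
  assume *: "0 \<le> v" "0 \<le> w" "x \<in> {x. 0 \<le> x \<and> x \<le> v}"
  define y where "y = (\<chi> j. min (x $ j) (w $ j))"
  have "dist x y \<le> dist v w"
    by (rule dist_le_componentwise) (use * in \<open>auto simp: y_def min_def abs_if less_eq_vec_def; smt\<close>)
  moreover have "y \<in> {x. 0 \<le> x \<and> x \<le> w}"
    using * by (auto simp: y_def less_eq_vec_def)
  ultimately show "\<exists>y\<in>{x. 0 \<le> x \<and> x \<le> w}. dist x y \<le> dist v w" by blast
qed auto

lemma le_face_sup:
  assumes "continuous_on nonneg_orthant f" "0 \<le> x" "x \<le> w" "x $ i = w $ i"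
  shows "f x $ i \<le> face_sup f i w"
  unfolding face_sup_def
  by (rule cSup_upper, use assms in force, rule bdd_above_component_image[OF assms(1), of _ w]) auto

lemma le_box_sup:
  assumes "continuous_on nonneg_orthant g" "0 \<le> x" "x \<le> w"
  shows "g x $ i \<le> box_sup g i w"
  unfolding box_sup_def
  by (rule cSup_upper, use assms in force, rule bdd_above_component_image[OF assms(1), of _ w]) auto

text \<open>Division by \<open>c\<close> maps the face of the box below \<open>c *\<^sub>R w\<close>
  onto the face of the box below \<open>w\<close>, and subhomogeneity compares the values of
  \<open>f\<close> at corresponding points. The same rescaling works for
  \<open>box_sup\<close>.\<close>

lemma face_sup_scaleR_le:
  assumes f: "continuous_on nonneg_orthant f" "subhomogeneous \<alpha> f" and c: "c \<ge> 1" and w: "0 \<le> w"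
  shows "face_sup f i (c *\<^sub>R w) \<le> c powr \<alpha> * face_sup f i w"
  unfolding face_sup_def[of f i "c *\<^sub>R w"]
proof (rule cSup_least)
  have "c *\<^sub>R w \<in> {x. 0 \<le> x \<and> x \<le> c *\<^sub>R w \<and> x $ i = (c *\<^sub>R w) $ i}"
    using c w by (auto simp: less_eq_vec_def)
  then show "(\<lambda>x. f x $ i) ` {x. 0 \<le> x \<and> x \<le> c *\<^sub>R w \<and> x $ i = (c *\<^sub>R w) $ i} \<noteq> {}" by blast
next
  fix r assume "r \<in> (\<lambda>x. f x $ i) ` {x. 0 \<le> x \<and> x \<le> c *\<^sub>R w \<and> x $ i = (c *\<^sub>R w) $ i}"
  then obtain x where x: "r = f x $ i" "0 \<le> x" "x \<le> c *\<^sub>R w" "x $ i = (c *\<^sub>R w) $ i" by auto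
  define y where "y = inverse c *\<^sub>R x"
  have y: "x = c *\<^sub>R y" "0 \<le> y" "y \<le> w" "y $ i = w $ i"
    using x c by (auto simp: y_def less_eq_vec_def field_simps)
  have "f (c *\<^sub>R y) \<le> c powr \<alpha> *\<^sub>R f y"
    using f(2) y c unfolding subhomogeneous_def nonneg_orthant_eq by auto
  then have "r \<le> c powr \<alpha> * f y $ i" using x y by (auto simp: less_eq_vec_def)
  also have "\<dots> \<le> c powr \<alpha> * face_sup f i w"
    using y le_face_sup[OF f(1)] by (intro mult_left_mono) auto
  finally show "r \<le> c powr \<alpha> * face_sup f i w" .
qed

lemma box_sup_scaleR_le:
  assumes g: "continuous_on nonneg_orthant g" "subhomogeneous \<alpha> g" and c: "c \<ge> 1" and w: "0 \<le> w"
  shows "box_sup g i (c *\<^sub>R w) \<le> c powr \<alpha> * box_sup g i w"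
  unfolding box_sup_def[of g i "c *\<^sub>R w"]
proof (rule cSup_least)
  have "c *\<^sub>R w \<in> {x. 0 \<le> x \<and> x \<le> c *\<^sub>R w}"
    using c w by (auto simp: less_eq_vec_def)
  then show "(\<lambda>x. g x $ i) ` {x. 0 \<le> x \<and> x \<le> c *\<^sub>R w} \<noteq> {}" by blast
next
  fix r assume "r \<in> (\<lambda>x. g x $ i) ` {x. 0 \<le> x \<and> x \<le> c *\<^sub>R w}"
  then obtain x where x: "r = g x $ i" "0 \<le> x" "x \<le> c *\<^sub>R w" by auto
  define y where "y = inverse c *\<^sub>R x"
  have y: "x = c *\<^sub>R y" "0 \<le> y" "y \<le> w"
    using x c by (auto simp: y_def less_eq_vec_def field_simps)
  have "g (c *\<^sub>R y) \<le> c powr \<alpha> *\<^sub>R g y"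
    using g(2) y c unfolding subhomogeneous_def nonneg_orthant_eq by auto
  then have "r \<le> c powr \<alpha> * g y $ i" using x y by (auto simp: less_eq_vec_def)
  also have "\<dots> \<le> c powr \<alpha> * box_sup g i w"
    using y le_box_sup[OF g(1)] by (intro mult_left_mono) auto
  finally show "r \<le> c powr \<alpha> * box_sup g i w" .
qed

section \<open>Brouwer's theorem and a point where all growth rates are negative\<close>

text \<open>If no coordinate of \<open>v\<close> is pushed up by the Brouwer map below, all \<open>h i v + e\<close> are nonpositive. Otherwise
  a fixed point has \<open>h i v + e > 0\<close> exactly on its support, while \<open>bdry\<close> excludes negative values off the
  support, contradicting \<open>neg\<close> made uniform by compactness.\<close>
lemma exists_common_negative_point:
  fixes h :: "'n::finite \<Rightarrow> real ^ 'n \<Rightarrow> real"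
  assumes cont: "\<And>i. continuous_on nonneg_orthant (h i)"
    and bdry: "\<And>i w. 0 \<le> w \<Longrightarrow> w $ i = 0 \<Longrightarrow> 0 \<le> h i w"
    and neg: "\<And>w. 0 \<le> w \<Longrightarrow> w \<noteq> 0 \<Longrightarrow> \<exists>i. h i w < 0"
    and r: "r > 0"
  obtains v where "0 \<le> v" "(\<Sum>i\<in>UNIV. v $ i) = r" "\<And>i. h i v < 0" "\<And>i. 0 < v $ i"
proof -
  define S :: "(real ^ 'n) set" where "S = {w. 0 \<le> w \<and> (\<Sum>i\<in>UNIV. w $ i) = r}"
  have sub: "S \<subseteq> nonneg_orthant" by (auto simp: S_def nonneg_orthant_eq)
  have Seq: "S = {0..(\<chi> i. r)} \<inter> {w. (\<Sum>i\<in>UNIV. w $ i) = r}"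
  proof -
    have "w $ i \<le> r" if "w \<in> S" for w i
      using that member_le_sum[of i UNIV "\<lambda>i. w $ i"] by (auto simp: S_def less_eq_vec_def)
    then show ?thesis by (auto simp: S_def less_eq_vec_def)
  qed
  have "compact S" unfolding Seq
    by (intro compact_Int_closed compact_interval closed_Collect_eq continuous_intros)
  have "convex S"
    unfolding S_def by (auto simp: convex_def less_eq_vec_def sum.distrib simp flip: sum_distrib_left distrib_right)
  have ne: "(\<chi> i. if i = k then r else 0) \<in> S" for k
    using r by (auto simp: S_def less_eq_vec_def)
  then have Sne: "S \<noteq> {}" by blast
  define m where "m w = Min (range (\<lambda>i. h i w))" for w
  have mcont: "continuous_on S m"
  proof -
    have "continuous_on S (\<lambda>w. Min ((\<lambda>i. h i w) ` A))" if "finite A" "A \<noteq> {}" for A :: "'n set"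
      using that
    proof (induction rule: finite_ne_induct)
      case (singleton x)
      then show ?case using continuous_on_subset[OF cont sub] by simp
    next
      case (insert x F)
      then show ?case using continuous_on_subset[OF cont sub] by (auto intro!: continuous_on_min)
    qed
    then show ?thesis unfolding m_def by auto
  qed
  obtain w0 where w0: "w0 \<in> S" "\<And>w. w \<in> S \<Longrightarrow> m w \<le> m w0"
    using continuous_attains_sup[OF \<open>compact S\<close> Sne mcont] by blast
  \<comment> \<open>A uniform margin: \<open>w0\<close> maximises \<open>m\<close>, so at each point
    of \<open>S\<close> some \<open>h i\<close> is at most \<open>- e\<close>.\<close>
  define e where "e = - m w0"
  have mneg: "m w < 0" if "w \<in> S" for w
  proof -
    have "w \<noteq> 0" using that r by (auto simp: S_def)
    moreover have "0 \<le> w" using that by (simp add: S_def)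
    ultimately obtain i where "h i w < 0" using neg by blast
    then show ?thesis unfolding m_def by (auto simp: Min_less_iff)
  qed
  have e: "e > 0" using mneg w0 by (simp add: e_def)
  have ex: "\<exists>i. h i w + e \<le> 0" if "w \<in> S" for w
  proof -
    have "m w \<in> range (\<lambda>i. h i w)" unfolding m_def by (rule Min_in) auto
    then show ?thesis using w0(2)[OF that] by (auto simp: e_def)
  qed
  define p where "p i w = max (h i w + e) 0" for i w
  define P where "P w = (\<Sum>i\<in>UNIV. p i w)" for w
  have p0: "p i w \<ge> 0" for i w by (simp add: p_def)
  have P0: "P w \<ge> 0" for w by (simp add: P_def p0 sum_nonneg)
  \<comment> \<open>Coordinates with \<open>h i w > - e\<close> are pushed up, and the division
    restores the coordinate sum: the numerators add up to \<open>r * (1 + P w)\<close>.\<close>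
  define T where "T w = (\<chi> i. (w $ i + r * p i w) / (1 + P w))" for w
  have "continuous_on S T"
    unfolding T_def P_def p_def
  proof (intro continuous_intros continuous_on_subset[OF cont sub] ballI)
    fix w
    show "1 + (\<Sum>i\<in>UNIV. max (h i w + e) 0) \<noteq> 0" using P0[of w] by (auto simp: P_def p_def)
  qed
  moreover have "T \<in> S \<rightarrow> S"
  proof
    fix w assume w: "w \<in> S"
    have "(\<Sum>i\<in>UNIV. T w $ i) = (\<Sum>i\<in>UNIV. w $ i + r * p i w) / (1 + P w)"
      by (simp add: T_def sum_divide_distrib)
    also have "\<dots> = (r + r * P w) / (1 + P w)"
      using w by (simp add: S_def sum.distrib P_def sum_distrib_left)
    also have "\<dots> = r" using P0[of w] by (simp add: field_simps)
    finally show "T w \<in> S"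
      using w p0 P0[of w] r by (auto simp: S_def T_def less_eq_vec_def)
  qed
  ultimately obtain v where v: "v \<in> S" "T v = v"
    using brouwer[OF \<open>compact S\<close> \<open>convex S\<close> Sne] by blast
  have fix': "v $ i * P v = r * p i v" for i
  proof -
    have "v $ i = (v $ i + r * p i v) / (1 + P v)"
      using v(2) by (metis T_def vec_lambda_beta)
    then show ?thesis using P0[of v] by (simp add: field_simps)
  qed
  have P: "P v = 0"
  proof (rule ccontr)
    assume P: "P v \<noteq> 0"
    obtain i where i: "h i v + e \<le> 0" using ex v by blast
    then have "p i v = 0" by (simp add: p_def)
    then have "v $ i = 0" using fix'[of i] P by simp
    then have "h i v \<ge> 0" using bdry v by (auto simp: S_def)
    with i e show False by simp
  qed
  have "p i v = 0" for i using fix'[of i] P r by simp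
  then have neg': "h i v < 0" for i using e unfolding p_def max_def by (smt (verit))
  moreover have "v $ i > 0" for i
    using neg'[of i] bdry[of v i] v by (auto simp: S_def less_eq_vec_def order_less_le)
  ultimately show ?thesis using that v by (auto simp: S_def)
qed

subsection \<open>Delay equations with bounded Lipschitz right-hand side\<close>

text \<open>The derivative is bounded on the compact set \<open>K\<close>, and convexity lets the
  mean value inequality turn this bound into a Lipschitz constant.\<close>

lemma C1_on_lipschitz:
  fixes f :: "real ^ 'n \<Rightarrow> real ^ 'm"
  assumes "C1_on D f" "K \<subseteq> D" "compact K" "convex K"
  obtains L where "L > 0" "\<And>x y. x \<in> K \<Longrightarrow> y \<in> K \<Longrightarrow> norm (f x - f y) \<le> L * norm (x - y)"
proof -
  obtain f' where f': "\<And>x. x \<in> D \<Longrightarrow> (f has_derivative blinfun_apply (f' x)) (at x)"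
    and cont: "continuous_on D f'"
    using assms(1) unfolding C1_on_def by blast
  have "bounded (f' ` K)"
    using assms cont by (intro compact_imp_bounded compact_continuous_image continuous_on_subset[OF cont])
  then obtain B where B: "\<And>x. x \<in> K \<Longrightarrow> norm (f' x) \<le> B" unfolding bounded_iff by auto
  have bound: "norm (f x - f y) \<le> (\<bar>B\<bar> + 1) * norm (x - y)" if "x \<in> K" "y \<in> K" for x y
  proof (rule differentiable_bound[OF \<open>convex K\<close> _ _ that])
    fix z assume z: "z \<in> K"
    show "(f has_derivative blinfun_apply (f' z)) (at z within K)"
      using f' z assms(2) has_derivative_at_withinI by blast
    show "onorm (blinfun_apply (f' z)) \<le> \<bar>B\<bar> + 1"
      using B[OF z] by (simp add: norm_blinfun.rep_eq)
  qed
  show thesis by (rule that[OF _ bound]) auto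
qed

text \<open>Near \<open>t\<close> the half-line agrees with \<open>{0..t+1}\<close>, which reduces
  the claim to the fundamental theorem of calculus on a compact interval.\<close>

lemma integral_upper_limit_has_vector_derivative:
  fixes u :: "real \<Rightarrow> 'a::banach"
  assumes "continuous_on {0..} u" "t \<ge> 0"
  shows "((\<lambda>t. integral {0..t} u) has_vector_derivative u t) (at t within {0..})"
proof -
  have "((\<lambda>t. integral {0..t} u) has_vector_derivative u t) (at t within {0..t+1})"
    using assms by (intro integral_has_vector_derivative continuous_on_subset[OF assms(1)]) auto
  moreover have "at t within {0..t+1} = at t within {0..}"
    by (rule at_within_nhd[of _ "{..<t+1}"]) auto
  ultimately show ?thesis by simp
qed

text \<open>The unknown of the contraction is \<open>u t = exp (- k * t) * x' t\<close>: it is bounded because \<open>F\<close> and \<open>G\<close> are, and the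
  exponential weight makes the contraction work on the whole half-line.\<close>
lemma delay_ode_global_solution:
  fixes F G :: "'a::euclidean_space \<Rightarrow> 'a" and \<phi> :: "real \<Rightarrow> 'a"
  assumes L: "L > 0"
    and FL: "\<And>x y. norm (F x - F y) \<le> L * norm (x - y)"
    and GL: "\<And>x y. norm (G x - G y) \<le> L * norm (x - y)"
    and FM: "\<And>x. norm (F x) \<le> M" and GM: "\<And>x. norm (G x) \<le> M"
    and \<tau>: "\<tau> \<ge> 0" and \<phi>: "continuous_on {-\<tau>..0} \<phi>"
  obtains x where "\<And>s. s \<in> {-\<tau>..0} \<Longrightarrow> x s = \<phi> s"
    and "\<And>t. t \<ge> 0 \<Longrightarrow> (x has_vector_derivative (F (x t) + G (x (t - \<tau>)))) (at t within {0..})"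
proof -
  \<comment> \<open>With this weight \<open>F\<close> and \<open>G\<close> each contribute
    \<open>L / k\<close>, so the contraction factor is \<open>2 * L / k = 1 / 2\<close>.\<close>
  define k where "k = 4 * L"
  have k: "k > 0" using L by (simp add: k_def)
  define E where "E u t = exp (k * t) *\<^sub>R apply_bcontfun u t" for u :: "real \<Rightarrow>\<^sub>C 'a" and t
  have Econt: "continuous_on S (E u)" for u S
    unfolding E_def by (intro continuous_intros continuous_on_apply_bcontfun)
  \<comment> \<open>\<open>X u\<close> is the trajectory with derivative \<open>E u\<close> at
    nonnegative times. Clamping the argument of \<open>\<phi>\<close> makes it continuous on the
    whole line.\<close>
  define X where "X u s = \<phi> (max (-\<tau>) (min s 0)) + integral {0..max s 0} (E u)" for u s
  have Xcont: "continuous_on UNIV (X u)" for u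
  proof -
    have "continuous_on {0..} (\<lambda>t. integral {0..t} (E u))"
      using integral_upper_limit_has_vector_derivative[OF Econt]
      by (intro continuous_on_vector_derivative[where f' = "E u"]) auto
    then have "continuous_on UNIV (\<lambda>s::real. integral {0..max s 0} (E u))"
      by (rule continuous_on_compose2) (auto intro!: continuous_intros)
    moreover have "continuous_on UNIV (\<lambda>s. \<phi> (max (-\<tau>) (min s 0)))"
      using \<tau> by (intro continuous_on_compose2[OF \<phi>]) (auto intro!: continuous_intros)
    ultimately show ?thesis unfolding X_def by (intro continuous_intros)
  qed
  have Fcont: "continuous_on UNIV F" and Gcont: "continuous_on UNIV G"
    using FL GL L by (auto intro!: lipschitz_on_continuous_on[of L] lipschitz_onI simp: dist_norm)
  \<comment> \<open>Bounded continuous functions live on the whole line here, so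
    \<open>max t 0\<close> extends the operator constantly to negative times.\<close>
  define T where "T u t = exp (- (k * max t 0)) *\<^sub>R (F (X u (max t 0)) + G (X u (max t 0 - \<tau>)))" for u t
  have Tb: "T u \<in> bcontfun" for u
  proof (rule bcontfun_normI)
    show "continuous_on UNIV (T u)"
      unfolding T_def
      by (intro continuous_intros continuous_on_compose2[OF Fcont] continuous_on_compose2[OF Gcont]
          continuous_on_compose2[OF Xcont]) auto
  next
    fix t
    have "norm (T u t) \<le> 1 * (M + M)"
      unfolding T_def norm_scaleR using FM GM k
      by (intro mult_mono norm_triangle_le add_mono) auto
    then show "norm (T u t) \<le> M + M" by simp
  qed
  \<comment> \<open>Integrating the weight \<open>exp (k * t)\<close> produces the decisive factor
    \<open>1 / k\<close>.\<close>
  have Xdist: "norm (X u s - X v s) \<le> exp (k * max s 0) * dist u v / k" for u v s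
  proof -
    define m where "m = max s 0"
    have int: "((\<lambda>t. exp (k * t) * dist u v) has_integral
        exp (k * m) * dist u v / k - exp (k * 0) * dist u v / k) {0..m}"
      using k by (intro fundamental_theorem_of_calculus)
        (auto intro!: derivative_eq_intros simp: m_def simp flip: has_real_derivative_iff_has_vector_derivative)
    have "X u s - X v s = integral {0..m} (\<lambda>t. E u t - E v t)"
      unfolding X_def m_def by (simp add: integral_diff integrable_continuous_real Econt)
    also have "norm \<dots> \<le> integral {0..m} (\<lambda>t. exp (k * t) * dist u v)"
    proof (rule integral_norm_bound_integral)
      fix t
      have "norm (E u t - E v t) = exp (k * t) * dist (apply_bcontfun u t) (apply_bcontfun v t)"
        by (simp add: E_def dist_norm flip: scaleR_right_diff_distrib)
      also have "\<dots> \<le> exp (k * t) * dist u v"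
        by (intro mult_left_mono dist_bounded) auto
      finally show "norm (E u t - E v t) \<le> exp (k * t) * dist u v" .
    qed (use int in \<open>auto intro!: integrable_continuous_real continuous_intros Econt\<close>)
    also have "\<dots> = exp (k * m) * dist u v / k - exp (k * 0) * dist u v / k"
      using int by (rule integral_unique)
    also have "\<dots> \<le> exp (k * m) * dist u v / k" using k by simp
    finally show ?thesis by (simp add: m_def)
  qed
  have contr: "dist (Bcontfun (T u)) (Bcontfun (T v)) \<le> 1 / 2 * dist u v" for u v
  proof (rule dist_bound)
    fix t :: real
    define m where "m = max t 0"
    have m: "m \<ge> 0" by (simp add: m_def)
    \<comment> \<open>The weight is increasing, so this bound also covers the delayed argument
      \<open>m - \<tau>\<close>.\<close>
    have le: "norm (X u s - X v s) \<le> exp (k * m) * dist u v / k" if "s \<le> m" for s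
    proof -
      have "exp (k * max s 0) \<le> exp (k * m)" using that k m by simp
      then have "exp (k * max s 0) * dist u v / k \<le> exp (k * m) * dist u v / k"
        using k by (intro divide_right_mono mult_right_mono) auto
      with Xdist[of u s v] show ?thesis by linarith
    qed
    have "T u t - T v t = exp (- (k * m)) *\<^sub>R
        ((F (X u m) - F (X v m)) + (G (X u (m - \<tau>)) - G (X v (m - \<tau>))))"
      by (simp add: T_def m_def algebra_simps)
    then have "norm (T u t - T v t) = exp (- (k * m)) *
        norm ((F (X u m) - F (X v m)) + (G (X u (m - \<tau>)) - G (X v (m - \<tau>))))"
      by simp
    also have "\<dots> \<le> exp (- (k * m)) * (L * (exp (k * m) * dist u v / k) + L * (exp (k * m) * dist u v / k))"
      using \<tau> L le[of m] le[of "m - \<tau>"]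
      by (intro mult_left_mono norm_triangle_le add_mono order_trans[OF FL] order_trans[OF GL]) auto
    also have "\<dots> = 1 / 2 * dist u v"
      using L by (simp add: k_def field_simps flip: exp_add)
    finally show "dist (apply_bcontfun (Bcontfun (T u)) t) (apply_bcontfun (Bcontfun (T v)) t) \<le> 1 / 2 * dist u v"
      by (simp add: Bcontfun_inverse Tb dist_norm)
  qed
  obtain u where u: "Bcontfun (T u) = u"
    using banach_fix_type[of "1/2" "\<lambda>u. Bcontfun (T u)"] contr by auto
  then have uT: "apply_bcontfun u t = T u t" for t by (metis Bcontfun_inverse Tb)
  show thesis
  proof (rule that[of "X u"])
    fix s assume "s \<in> {-\<tau>..0}"
    then show "X u s = \<phi> s" by (auto simp: X_def max_def min_def)
  next
    fix t :: real assume t: "t \<ge> 0"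
    have "((\<lambda>t. \<phi> 0 + integral {0..t} (E u)) has_vector_derivative E u t) (at t within {0..})"
      using integral_upper_limit_has_vector_derivative[OF Econt t, of u]
      by (auto intro!: derivative_eq_intros)
    then have "(X u has_vector_derivative E u t) (at t within {0..})"
      by (rule has_vector_derivative_transform[rotated 2]) (use t \<tau> in \<open>auto simp: X_def\<close>)
    moreover have "E u t = F (X u t) + G (X u (t - \<tau>))"
      using t by (simp add: E_def uT T_def flip: exp_add)
    ultimately show "(X u has_vector_derivative (F (X u t) + G (X u (t - \<tau>)))) (at t within {0..})"
      by simp
  qed
qed

section \<open>A comparison principle for scalar functions\<close>

text \<open>If \<open>y t > b\<close>, the mean value theorem between \<open>t\<close> and the last
  earlier time with \<open>y \<le> b\<close> gives a contradiction. Asking for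
  \<open>d t \<le> 0\<close> only where \<open>y t > b\<close> suits clamped systems: beyond a face
  the clamped point lies exactly on it.\<close>

lemma le_of_derivative_nonpos_above:
  fixes y d :: "real \<Rightarrow> real"
  assumes der: "\<And>t. t \<ge> a \<Longrightarrow> (y has_vector_derivative d t) (at t within {a..})"
    and init: "y a \<le> b" and nonpos: "\<And>t. t \<ge> a \<Longrightarrow> y t > b \<Longrightarrow> d t \<le> 0" and t: "t \<ge> a"
  shows "y t \<le> b"
proof (rule ccontr)
  assume yt: "\<not> y t \<le> b"
  have "continuous_on {a..} y"
    using der by (intro continuous_on_vector_derivative) auto
  then have cont: "continuous_on {a..t} y" by (rule continuous_on_subset) auto
  define S where "S = {s\<in>{a..t}. y s \<le> b}"
  have "closed S" unfolding S_def
    using cont by (intro continuous_on_closed_Collect_le continuous_intros) auto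
  then have "compact S"
    unfolding compact_eq_bounded_closed
    by (auto simp: S_def intro: bounded_subset[OF bounded_closed_interval, of _ a t])
  moreover have "S \<noteq> {}" using init t by (auto simp: S_def)
  ultimately obtain c where c: "c \<in> S" "\<And>s. s \<in> S \<Longrightarrow> s \<le> c"
    using compact_attains_sup[of S] by blast
  have ct: "c < t" "a \<le> c" "y c \<le> b" using c yt by (auto simp: S_def order_less_le)
  have "continuous_on {c..t} y" by (rule continuous_on_subset[OF cont]) (use ct in auto)
  moreover have "(y has_derivative (\<lambda>h. h *\<^sub>R d s)) (at s)" if "c < s" "s < t" for s
  proof -
    have "at s within {a..} = at s"
      by (rule at_within_interior) (use that ct in \<open>auto simp: interior_Ici\<close>)
    then show ?thesis using der[of s] that ct by (auto simp: has_vector_derivative_def)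
  qed
  ultimately obtain s where s: "c < s" "s < t" "y t - y c = (t - c) *\<^sub>R d s"
    using mvt[OF ct(1), of y "\<lambda>s h. h *\<^sub>R d s"] by blast
  have "y s > b" using s c(2)[of s] ct by (force simp: S_def)
  then have "(t - c) *\<^sub>R d s \<le> 0" using nonpos[of s] s ct by (auto intro: mult_nonneg_nonpos)
  with s ct yt show False by linarith
qed

subsection \<open>Positive delay systems\<close>

lemma has_vector_derivative_vec_nth:
  fixes x :: "real \<Rightarrow> real ^ 'n"
  assumes "(x has_vector_derivative v) F"
  shows "((\<lambda>t. x t $ i) has_vector_derivative v $ i) F"
  using bounded_linear.has_vector_derivative[OF bounded_linear_vec_nth assms] .

locale positive_delay_system =
  fixes f g :: "real ^ 'n \<Rightarrow> real ^ 'n" and D :: "(real ^ 'n) set"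
  assumes open_D: "open D" and orthant_subset: "nonneg_orthant \<subseteq> D"
    and C1_f: "C1_on D f" and C1_g: "C1_on D g"
    and g_nonneg: "\<And>x. x \<in> nonneg_orthant \<Longrightarrow> 0 \<le> g x"
    and f_boundary: "\<And>i x. x \<in> nonneg_orthant \<Longrightarrow> x $ i = 0 \<Longrightarrow> 0 \<le> f x $ i"
begin

lemma C1_on_imp_continuous_on: "C1_on D h \<Longrightarrow> continuous_on nonneg_orthant h"
  unfolding C1_on_def using orthant_subset
  by (meson continuous_at_imp_continuous_on has_derivative_continuous subsetD)

lemmas cont_f = C1_on_imp_continuous_on[OF C1_f]
lemmas cont_g = C1_on_imp_continuous_on[OF C1_g]

text \<open>The \<open>h i w\<close> of the introductory text: it bounds the derivative of component
  \<open>i\<close> when the current state lies on the upper face of \<open>{0..w}\<close> in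
  direction \<open>i\<close> and the delayed state lies in the box.\<close>

definition growth :: "'n \<Rightarrow> real ^ 'n \<Rightarrow> real" where
  "growth i w = face_sup f i w + box_sup g i w"

text \<open>The corner \<open>w\<close> itself lies on the face, and there component
  \<open>i\<close> of both \<open>f\<close> and \<open>g\<close> is nonnegative. This is the
  boundary condition of the Brouwer argument.\<close>

lemma growth_nonneg_boundary:
  assumes "0 \<le> w" "w $ i = 0"
  shows "0 \<le> growth i w"
proof -
  have "0 \<le> f w $ i" "0 \<le> g w $ i"
    using f_boundary[of w i] g_nonneg[of w] assms by (auto simp: nonneg_orthant_eq less_eq_vec_def)
  then show ?thesis
    using le_face_sup[OF cont_f, of w w i] le_box_sup[OF cont_g, of w w i] assms
    unfolding growth_def by auto
qed

section \<open>Invariant boxes and existence of solutions\<close>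

text \<open>The solution of the clamped system never leaves the box, where clamping is the identity,
  so it solves the original system.\<close>

lemma exists_bounded_solution:
  assumes b: "0 \<le> b" "\<And>i. growth i b \<le> 0" and \<tau>: "\<tau> \<ge> 0" and \<phi>: "\<phi> \<in> init_space \<tau>"
    and \<phi>b: "\<And>s. s \<in> {-\<tau>..0} \<Longrightarrow> \<phi> s \<le> b"
  obtains x where "dde_solution f g \<tau> \<phi> x" "\<And>t. t \<ge> -\<tau> \<Longrightarrow> x t \<in> {0..b}"
proof -
  \<comment> \<open>The coordinatewise clamp is nonexpansive, so \<open>f\<close> and
    \<open>g\<close> composed with it have a global Lipschitz constant and a global bound.\<close>
  define P :: "real ^ 'n \<Rightarrow> real ^ 'n" where "P x = (\<chi> i. max 0 (min (x $ i) (b $ i)))" for x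
  have Pmem: "P x \<in> {0..b}" for x using b(1) by (auto simp: P_def less_eq_vec_def)
  have Pid: "P x = x" if "x \<in> {0..b}" for x
    using that by (auto simp: P_def less_eq_vec_def vec_eq_iff max_def min_def)
  have Plip: "norm (P x - P y) \<le> norm (x - y)" for x y
    by (rule norm_le_componentwise_cart) (auto simp: P_def max_def min_def)
  have boxD: "{0..b} \<subseteq> D" using orthant_subset by (auto simp: nonneg_orthant_eq)
  obtain Lf where Lf: "Lf > 0" "\<And>x y. x \<in> {0..b} \<Longrightarrow> y \<in> {0..b} \<Longrightarrow> norm (f x - f y) \<le> Lf * norm (x - y)"
    using C1_on_lipschitz[OF C1_f boxD] by (auto simp: compact_interval)
  obtain Lg where Lg: "Lg > 0" "\<And>x y. x \<in> {0..b} \<Longrightarrow> y \<in> {0..b} \<Longrightarrow> norm (g x - g y) \<le> Lg * norm (x - y)"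
    using C1_on_lipschitz[OF C1_g boxD] by (auto simp: compact_interval)
  have lip: "norm (h (P x) - h (P y)) \<le> (Lf + Lg) * norm (x - y)"
    if "\<And>x y. x \<in> {0..b} \<Longrightarrow> y \<in> {0..b} \<Longrightarrow> norm (h x - h y) \<le> L * norm (x - y)" "L > 0" "L \<le> Lf + Lg"
    for h :: "real ^ 'n \<Rightarrow> real ^ 'n" and L x y
  proof -
    have "norm (h (P x) - h (P y)) \<le> L * norm (P x - P y)" using that Pmem by blast
    also have "\<dots> \<le> (Lf + Lg) * norm (x - y)" using Plip that by (intro mult_mono) auto
    finally show ?thesis .
  qed
  have bdd: "\<exists>M. \<forall>x. norm (h (P x)) \<le> M" if "C1_on D h" for h :: "real ^ 'n \<Rightarrow> real ^ 'n"
  proof -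
    have "continuous_on {0..b} h"
      by (rule continuous_on_subset[OF C1_on_imp_continuous_on[OF that]]) (auto simp: nonneg_orthant_eq)
    then have "bounded (h ` {0..b})"
      by (intro compact_imp_bounded compact_continuous_image compact_interval)
    then show ?thesis using Pmem unfolding bounded_iff by blast
  qed
  obtain Mf Mg where M: "\<And>x. norm (f (P x)) \<le> Mf" "\<And>x. norm (g (P x)) \<le> Mg"
    using bdd[OF C1_f] bdd[OF C1_g] by metis
  obtain x where x: "\<And>s. s \<in> {-\<tau>..0} \<Longrightarrow> x s = \<phi> s"
    "\<And>t. t \<ge> 0 \<Longrightarrow> (x has_vector_derivative (f (P (x t)) + g (P (x (t - \<tau>))))) (at t within {0..})"
  proof (rule delay_ode_global_solution[of "Lf + Lg" "\<lambda>x. f (P x)" "\<lambda>x. g (P x)" "max Mf Mg" \<tau> \<phi>])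
    show "Lf + Lg > 0" using Lf Lg by simp
    show "norm (f (P x) - f (P y)) \<le> (Lf + Lg) * norm (x - y)" for x y
      using lip[OF Lf(2)] Lf(1) Lg(1) by simp
    show "norm (g (P x) - g (P y)) \<le> (Lf + Lg) * norm (x - y)" for x y
      using lip[OF Lg(2)] Lf(1) Lg(1) by simp
    show "norm (f (P x)) \<le> max Mf Mg" for x using M(1)[of x] by simp
    show "norm (g (P x)) \<le> max Mf Mg" for x using M(2)[of x] by simp
    show "continuous_on {-\<tau>..0} \<phi>" using \<phi> by (simp add: init_space_def)
  qed (use \<tau> in auto)
  have der: "((\<lambda>t. x t $ i) has_vector_derivative (f (P (x t)) $ i + g (P (x (t - \<tau>))) $ i)) (at t within {0..})"
    if "t \<ge> 0" for t i
    using has_vector_derivative_vec_nth[OF x(2)[OF that], of i] by simp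
  have x0: "0 \<le> x 0 $ i" "x 0 $ i \<le> b $ i" for i
    using x(1)[of 0] \<tau> \<phi> \<phi>b[of 0] by (auto simp: init_space_def nonneg_orthant_def less_eq_vec_def)
  \<comment> \<open>Beyond the upper face the clamped state lies on that face, so the derivative is
    at most \<open>growth i b\<close>.\<close>
  have upper: "x t $ i \<le> b $ i" if "t \<ge> 0" for t i
  proof (rule le_of_derivative_nonpos_above[OF der x0(2) _ that])
    fix t :: real assume "b $ i < x t $ i"
    then have "P (x t) $ i = b $ i" using b(1) by (auto simp: P_def less_eq_vec_def)
    then show "f (P (x t)) $ i + g (P (x (t - \<tau>))) $ i \<le> 0"
      using le_face_sup[OF cont_f, of "P (x t)" b i] le_box_sup[OF cont_g, of "P (x (t - \<tau>))" b i]
        Pmem b(2)[of i] unfolding growth_def by fastforce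
  qed
  \<comment> \<open>The same comparison for the negated component: below zero the clamped state has
    coordinate \<open>i\<close> equal to 0, where the sign conditions on \<open>f\<close> and
    \<open>g\<close> apply.\<close>
  have lower: "- x t $ i \<le> 0" if "t \<ge> 0" for t i
  proof (rule le_of_derivative_nonpos_above[OF _ _ _ that])
    fix t :: real assume "0 \<le> t"
    then show "((\<lambda>t. - x t $ i) has_vector_derivative - (f (P (x t)) $ i + g (P (x (t - \<tau>))) $ i)) (at t within {0..})"
      by (intro has_vector_derivative_minus der)
  next
    fix t :: real assume "0 < - x t $ i"
    then have "P (x t) $ i = 0" by (auto simp: P_def)
    moreover have PO: "P z \<in> nonneg_orthant" for z using Pmem by (auto simp: nonneg_orthant_eq)
    moreover have "0 \<le> g (P (x (t - \<tau>))) $ i"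
      using g_nonneg[OF PO] by (simp add: less_eq_vec_def)
    ultimately show "- (f (P (x t)) $ i + g (P (x (t - \<tau>))) $ i) \<le> 0"
      using f_boundary[of "P (x t)" i] by auto
  qed (use x0(1)[of i] in simp)
  have mem: "x t \<in> {0..b}" if "t \<ge> -\<tau>" for t
  proof (cases "t \<ge> 0")
    case True
    then show ?thesis using upper lower by (auto simp: less_eq_vec_def)
  next
    case False
    then show ?thesis using that x(1)[of t] \<phi> \<phi>b[of t] by (auto simp: init_space_def nonneg_orthant_eq)
  qed
  have "dde_solution f g \<tau> \<phi> x"
    unfolding dde_solution_def
  proof (intro conjI ballI allI impI)
    fix t :: real assume t: "0 \<le> t"
    then have "P (x t) = x t" "P (x (t - \<tau>)) = x (t - \<tau>)" using \<tau> by (auto intro!: Pid mem)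
    then show "(x has_vector_derivative f (x t) + g (x (t - \<tau>))) (at t within {0..})"
      using x(2)[OF t] by simp
  qed (use x(1) in blast)
  then show thesis using that mem by blast
qed

section \<open>Uniqueness of solutions\<close>

lemma dde_solution_continuous_on: "dde_solution f g \<tau> \<phi> x \<Longrightarrow> continuous_on {0..} x"
  unfolding dde_solution_def by (rule continuous_on_vector_derivative) auto

text \<open>Only \<open>y\<close> is assumed to stay in \<open>D\<close>. At the infimum
  \<open>p\<close> of the times of disagreement the solutions still agree, so shortly after
  \<open>p\<close> both lie in a ball inside \<open>D\<close> on which \<open>f\<close> and
  \<open>g\<close> are Lipschitz. On a short interval the largest difference \<open>B\<close> then
  satisfies \<open>B \<le> B / 2\<close>.\<close>

lemma dde_solution_unique:
  assumes \<tau>: "\<tau> \<ge> 0" and x: "dde_solution f g \<tau> \<phi> x" and y: "dde_solution f g \<tau> \<phi> y"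
    and yD: "\<And>t. t \<ge> 0 \<Longrightarrow> y t \<in> D" and t: "t \<ge> -\<tau>"
  shows "x t = y t"
proof (rule ccontr)
  assume neq: "x t \<noteq> y t"
  have init: "x s = y s" if "s \<in> {-\<tau>..0}" for s using x y that by (simp add: dde_solution_def)
  have contx: "continuous_on {0..} x" and conty: "continuous_on {0..} y"
    using dde_solution_continuous_on x y by blast+
  define S where "S = {s. 0 \<le> s \<and> x s \<noteq> y s}"
  have tS: "t \<in> S" using neq t init[of t] by (force simp: S_def)
  have bdd: "bdd_below S" by (auto simp: S_def intro: bdd_belowI[of _ 0])
  define p where "p = Inf S"
  have p0: "p \<ge> 0" unfolding p_def using tS by (intro cInf_greatest) (auto simp: S_def)
  have before: "x s = y s" if "-\<tau> \<le> s" "s < p" for s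
  proof (rule ccontr)
    assume "x s \<noteq> y s"
    then have "s \<in> S" using init[of s] that by (force simp: S_def)
    then show False using cInf_lower[OF _ bdd, of s] that by (simp add: p_def)
  qed
  have xp: "x p = y p"
  proof (cases "p = 0")
    case True
    then show ?thesis using init[of 0] \<tau> by simp
  next
    case False
    define A where "A = {s\<in>{0..p}. x s = y s}"
    have "closed {s\<in>{0..p}. x s - y s = 0}"
      by (intro continuous_closed_preimage_constant continuous_intros
          continuous_on_subset[OF contx] continuous_on_subset[OF conty]) auto
    then have "closed A" by (simp add: A_def)
    moreover have "{0..<p} \<subseteq> A" using before \<tau> by (auto simp: A_def)
    ultimately have "closure {0..<p} \<subseteq> A" by (rule closure_minimal[rotated])
    then show ?thesis using False p0 by (auto simp: A_def)
  qed
  obtain r where r: "r > 0" "cball (y p) r \<subseteq> D"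
    using open_D yD[OF p0] open_contains_cball by blast
  obtain Lf where Lf: "Lf > 0"
    "\<And>u v. u \<in> cball (y p) r \<Longrightarrow> v \<in> cball (y p) r \<Longrightarrow> norm (f u - f v) \<le> Lf * norm (u - v)"
    using C1_on_lipschitz[OF C1_f r(2)] by auto
  obtain Lg where Lg: "Lg > 0"
    "\<And>u v. u \<in> cball (y p) r \<Longrightarrow> v \<in> cball (y p) r \<Longrightarrow> norm (g u - g v) \<le> Lg * norm (u - v)"
    using C1_on_lipschitz[OF C1_g r(2)] by auto
  obtain d1 where d1: "d1 > 0" "\<And>s. s \<ge> 0 \<Longrightarrow> dist s p < d1 \<Longrightarrow> dist (x s) (y p) < r"
    using contx p0 r(1) xp unfolding continuous_on_iff by (metis atLeast_iff)
  obtain d2 where d2: "d2 > 0" "\<And>s. s \<ge> 0 \<Longrightarrow> dist s p < d2 \<Longrightarrow> dist (y s) (y p) < r"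
    using conty p0 r(1) unfolding continuous_on_iff by (metis atLeast_iff)
  \<comment> \<open>Halving the minimum gives \<open>h < d1\<close>, \<open>h < d2\<close> and
    \<open>(Lf + Lg) * h \<le> 1 / 2\<close> at once.\<close>
  define h where "h = min (min d1 d2) (1 / (Lf + Lg)) / 2"
  have h: "h > 0" "h < d1" "h < d2"
    using d1(1) d2(1) Lf(1) Lg(1) by (auto simp: h_def min_less_iff_disj)
  have hL: "(Lf + Lg) * h \<le> 1 / 2"
  proof -
    have "(Lf + Lg) * h \<le> (Lf + Lg) * (1 / (Lf + Lg) / 2)"
      unfolding h_def using Lf(1) Lg(1) by (intro mult_left_mono divide_right_mono) auto
    also have "\<dots> = 1 / 2" using Lf(1) Lg(1) by simp
    finally show ?thesis .
  qed
  define I where "I = {p..p+h}"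
  have ball: "x s \<in> cball (y p) r" "y s \<in> cball (y p) r" if "s \<in> I" for s
    using d1(2)[of s] d2(2)[of s] that h p0 by (auto simp: I_def dist_real_def dist_commute less_imp_le)
  have "continuous_on I (\<lambda>s. norm (x s - y s))"
    using p0 by (intro continuous_intros continuous_on_subset[OF contx] continuous_on_subset[OF conty]) (auto simp: I_def)
  moreover have "compact I" "I \<noteq> {}" using h by (auto simp: I_def)
  ultimately obtain m where m: "m \<in> I" "\<And>s. s \<in> I \<Longrightarrow> norm (x s - y s) \<le> norm (x m - y m)"
    using continuous_attains_sup[of I "\<lambda>s. norm (x s - y s)"] by blast
  define B where "B = norm (x m - y m)"
  \<comment> \<open>The delayed time falls either before \<open>p\<close>, where the solutions
    agree, or into \<open>I\<close>; this covers arbitrarily small delays, including zero.\<close>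
  have delayed: "norm (g (x (s - \<tau>)) - g (y (s - \<tau>))) \<le> Lg * B" if s: "s \<in> I" for s
  proof (cases "s - \<tau> < p")
    case True
    then have "x (s - \<tau>) = y (s - \<tau>)" using before s p0 by (auto simp: I_def)
    then show ?thesis using Lg(1) by (simp add: B_def)
  next
    case False
    then have I: "s - \<tau> \<in> I" using s \<tau> by (auto simp: I_def)
    have "norm (g (x (s - \<tau>)) - g (y (s - \<tau>))) \<le> Lg * norm (x (s - \<tau>) - y (s - \<tau>))"
      using Lg(2) ball[OF I] by blast
    also have "\<dots> \<le> Lg * B" using Lg(1) m(2)[OF I] by (simp add: B_def)
    finally show ?thesis .
  qed
  have "norm ((x m - y m) - (x p - y p)) \<le> ((Lf + Lg) * B) * norm (m - p)"
  proof (rule differentiable_bound[where S = I and f' = "\<lambda>s c. c *\<^sub>R ((f (x s) + g (x (s - \<tau>))) - (f (y s) + g (y (s - \<tau>))))"])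
    fix s assume s: "s \<in> I"
    have "((\<lambda>s. x s - y s) has_vector_derivative ((f (x s) + g (x (s - \<tau>))) - (f (y s) + g (y (s - \<tau>))))) (at s within {0..})"
      using x y s p0 unfolding dde_solution_def I_def by (intro has_vector_derivative_diff) auto
    then show "((\<lambda>s. x s - y s) has_derivative (\<lambda>c. c *\<^sub>R ((f (x s) + g (x (s - \<tau>))) - (f (y s) + g (y (s - \<tau>)))))) (at s within I)"
      unfolding has_vector_derivative_def
      by (rule has_derivative_subset) (use p0 in \<open>auto simp: I_def\<close>)
    have "norm (f (x s) - f (y s)) \<le> Lf * B"
      using order_trans[OF Lf(2)[OF ball[OF s]], of "Lf * B"] mult_left_mono[OF m(2)[OF s], of Lf] Lf(1)
      by (simp add: B_def)
    then have "norm ((f (x s) + g (x (s - \<tau>))) - (f (y s) + g (y (s - \<tau>)))) \<le> (Lf + Lg) * B"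
      using delayed[OF s] norm_triangle_ineq[of "f (x s) - f (y s)" "g (x (s - \<tau>)) - g (y (s - \<tau>))"]
      by (simp add: algebra_simps)
    then show "onorm (\<lambda>c. c *\<^sub>R ((f (x s) + g (x (s - \<tau>))) - (f (y s) + g (y (s - \<tau>))))) \<le> (Lf + Lg) * B"
      by (intro onorm_le) (simp add: mult.commute mult_left_mono)
  qed (use m(1) h(1) in \<open>auto simp: I_def\<close>)
  also have "\<dots> \<le> ((Lf + Lg) * B) * h"
    using m(1) Lf(1) Lg(1) by (intro mult_left_mono) (auto simp: I_def B_def)
  also have "\<dots> = ((Lf + Lg) * h) * B" by simp
  also have "\<dots> \<le> 1 / 2 * B" using hL by (intro mult_right_mono) (auto simp: B_def)
  finally have "B \<le> 1 / 2 * B" using xp by (simp add: B_def)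
  then have "B \<le> 0" by simp
  then have eq: "x s = y s" if "s \<in> I" for s using m(2)[OF that] by (simp add: B_def)
  obtain s where s: "s \<in> S" "s < p + h"
    using cInf_lessD[of S "p + h"] tS h(1) by (auto simp: p_def)
  moreover have "p \<le> s" using cInf_lower[OF s(1) bdd] by (simp add: p_def)
  ultimately show False using eq[of s] by (auto simp: I_def S_def)
qed

text \<open>The solution constructed in the box stays in \<open>D\<close>, so by uniqueness every
  solution with the same initial data coincides with it.\<close>

lemma dde_solution_bounded:
  assumes b: "0 \<le> b" "\<And>i. growth i b \<le> 0" and \<tau>: "\<tau> \<ge> 0" and \<phi>: "\<phi> \<in> init_space \<tau>"
    and \<phi>b: "\<And>s. s \<in> {-\<tau>..0} \<Longrightarrow> \<phi> s \<le> b"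
    and x: "dde_solution f g \<tau> \<phi> x" and t: "t \<ge> -\<tau>"
  shows "x t \<in> {0..b}"
proof -
  obtain y where y: "dde_solution f g \<tau> \<phi> y" "\<And>t. t \<ge> -\<tau> \<Longrightarrow> y t \<in> {0..b}"
    using exists_bounded_solution[OF b \<tau> \<phi> \<phi>b] by blast
  have "y t \<in> D" if "t \<ge> 0" for t
    using y(2)[of t] that \<tau> orthant_subset by (auto simp: nonneg_orthant_eq)
  then show ?thesis using dde_solution_unique[OF \<tau> x y(1) _ t] y(2)[OF t] by simp
qed

section \<open>Convergence to the origin\<close>

lemma dde_solution_tendsto_0:
  assumes neg: "\<And>w. 0 \<le> w \<Longrightarrow> w \<noteq> 0 \<Longrightarrow> \<exists>i. growth i w < 0"
    and \<tau>: "\<tau> \<ge> 0" and x: "dde_solution f g \<tau> \<phi> x" and xb: "\<And>t. t \<ge> -\<tau> \<Longrightarrow> x t \<in> {0..b}"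
  shows "(x \<longlongrightarrow> 0) at_top"
proof -
  \<comment> \<open>\<open>C i\<close> collects the eventual upper bounds of component
    \<open>i\<close>; its infimum is the limit superior, which \<open>xb\<close> keeps
    finite.\<close>
  define C where "C i = {c. eventually (\<lambda>t. x t $ i \<le> c) at_top}" for i
  have ev0: "eventually (\<lambda>t. 0 \<le> x t $ i \<and> x t $ i \<le> b $ i) at_top" for i
    using xb by (intro eventually_at_top_linorderI[of "-\<tau>"]) (auto simp: less_eq_vec_def)
  have Cpos: "0 \<le> c" if "c \<in> C i" for c i
  proof -
    have "eventually (\<lambda>t::real. 0 \<le> c) at_top"
      using that[unfolded C_def mem_Collect_eq] ev0[of i] by eventually_elim auto
    then show ?thesis by simp
  qed
  have bdd: "bdd_below (C i)" for i using Cpos by (rule bdd_belowI)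
  have bC: "b $ i \<in> C i" for i
    unfolding C_def using ev0[of i] by (auto elim: eventually_mono)
  define w where "w = (\<chi> i. Inf (C i))"
  have w0: "0 \<le> w"
    using bC Cpos by (auto simp: w_def less_eq_vec_def intro!: cInf_greatest)
  have above: "eventually (\<lambda>t. x t $ i \<le> w $ i + e) at_top" if e: "e > 0" for i e
  proof -
    obtain c where "c \<in> C i" "c < w $ i + e"
      using cInf_lessD[of "C i" "w $ i + e"] bC[of i] e by (auto simp: w_def)
    then show ?thesis unfolding C_def by (auto elim: eventually_mono)
  qed
  have "w = 0"
  proof (rule ccontr)
    assume "w \<noteq> 0"
    then obtain i where i: "growth i w < 0" using neg w0 by blast
    \<comment> \<open>Since \<open>growth i w = - 4 * \<eta>\<close>, two continuity errors below
      \<open>\<eta>\<close> still leave a decay rate of at least \<open>\<eta>\<close>.\<close>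
    define \<eta> where "\<eta> = - growth i w / 4"
    have \<eta>: "\<eta> > 0" using i by (simp add: \<eta>_def)
    have wO: "w \<in> nonneg_orthant" using w0 by (simp add: nonneg_orthant_eq)
    obtain d1 where d1: "d1 > 0"
      "\<And>v. 0 \<le> v \<Longrightarrow> dist v w < d1 \<Longrightarrow> dist (face_sup f i v) (face_sup f i w) < \<eta>"
      using continuous_on_face_sup[OF cont_f, unfolded continuous_on_iff, rule_format, OF wO \<eta>, of i]
      unfolding nonneg_orthant_eq by blast
    obtain d2 where d2: "d2 > 0"
      "\<And>v. 0 \<le> v \<Longrightarrow> dist v w < d2 \<Longrightarrow> dist (box_sup g i v) (box_sup g i w) < \<eta>"
      using continuous_on_box_sup[OF cont_g, unfolded continuous_on_iff, rule_format, OF wO \<eta>, of i]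
      unfolding nonneg_orthant_eq by blast
    \<comment> \<open>Moving every coordinate by at most \<open>e\<close> changes the norm by at
      most half of \<open>min d1 d2\<close>, by comparison with the sum of the coordinates.\<close>
    define e where "e = min d1 d2 / (2 * CARD('n))"
    have e: "e > 0" using d1 d2 by (simp add: e_def)
    have dist_e: "dist v w < min d1 d2" if "\<And>j. \<bar>v $ j - w $ j\<bar> \<le> e" for v
    proof -
      have "norm (v - w) \<le> (\<Sum>j\<in>UNIV. \<bar>(v - w) $ j\<bar>)" by (rule norm_le_l1_cart)
      also have "\<dots> \<le> (\<Sum>j\<in>(UNIV::'n set). e)" using that by (intro sum_mono) auto
      also have "\<dots> = min d1 d2 / 2" by (simp add: e_def)
      also have "\<dots> < min d1 d2" using d1(1) d2(1) by linarith
      finally show ?thesis by (simp add: dist_norm)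
    qed
    have "eventually (\<lambda>t. \<forall>j. x t $ j \<le> w $ j + e) at_top"
      using above[OF e] by (intro eventually_all_finite) auto
    then obtain T0 where T0: "\<And>t j. t \<ge> T0 \<Longrightarrow> x t $ j \<le> w $ j + e"
      unfolding eventually_at_top_linorder by blast
    \<comment> \<open>Adding \<open>\<tau>\<close> makes the eventual bound hold for the delayed
      state too.\<close>
    define T where "T = max T0 0 + \<tau>"
    define V where "V t = f (x t) $ i + g (x (t - \<tau>)) $ i" for t
    have decay: "V t \<le> - \<eta>" if t: "t \<ge> T" and xt: "x t $ i > w $ i - e" for t
    proof -
      \<comment> \<open>\<open>u\<close> is the corner of a box with \<open>x t\<close> on its upper
        face in direction \<open>i\<close>, and \<open>v\<close> the corner of a box containing the
        delayed state; both are close to \<open>w\<close>.\<close>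
      define u where "u = (\<chi> j. if j = i then x t $ i else w $ j + e)"
      define v where "v = (\<chi> j. w $ j + e)"
      have x0: "0 \<le> x t" "0 \<le> x (t - \<tau>)" using xb[of t] xb[of "t - \<tau>"] t \<tau> by (auto simp: T_def)
      have le: "x t $ j \<le> w $ j + e" "x (t - \<tau>) $ j \<le> w $ j + e" for j
        using T0[of t j] T0[of "t - \<tau>" j] t \<tau> by (auto simp: T_def)
      have u: "x t \<le> u" "x t $ i = u $ i" and v: "x (t - \<tau>) \<le> v"
        using le by (auto simp: u_def v_def less_eq_vec_def)
      have "dist u w < min d1 d2"
        by (rule dist_e) (use le(1)[of i] xt e in \<open>auto simp: u_def abs_le_iff\<close>)
      moreover have "dist v w < min d1 d2"
        by (rule dist_e) (use e in \<open>simp add: v_def\<close>)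
      moreover have "0 \<le> u" "0 \<le> v" using x0 u v by (auto intro: order_trans)
      ultimately have "face_sup f i u < face_sup f i w + \<eta>" "box_sup g i v < box_sup g i w + \<eta>"
        using d1(2)[of u] d2(2)[of v] by (auto simp: dist_real_def)
      moreover have "f (x t) $ i \<le> face_sup f i u" "g (x (t - \<tau>)) $ i \<le> box_sup g i v"
        using le_face_sup[OF cont_f x0(1) u] le_box_sup[OF cont_g x0(2) v] by auto
      moreover have "face_sup f i w + box_sup g i w = - 4 * \<eta>" by (simp add: \<eta>_def growth_def)
      ultimately show ?thesis using \<eta> unfolding V_def by linarith
    qed
    have der: "((\<lambda>t. x t $ i) has_vector_derivative V t) (at t within {a..})" if "a \<ge> 0" "t \<ge> a" for a t
    proof -
      have "(x has_vector_derivative f (x t) + g (x (t - \<tau>))) (at t within {0..})"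
        using x that by (simp add: dde_solution_def)
      then have "((\<lambda>t. x t $ i) has_vector_derivative V t) (at t within {0..})"
        using has_vector_derivative_vec_nth by (fastforce simp: V_def)
      then show ?thesis by (rule has_vector_derivative_within_subset) (use that in auto)
    qed
    have T: "T \<ge> 0" using \<tau> by (simp add: T_def)
    \<comment> \<open>Otherwise component \<open>i\<close> would decrease at rate at least
      \<open>\<eta>\<close> forever and become negative.\<close>
    have "\<exists>a\<ge>T. x a $ i \<le> w $ i - e"
    proof (rule ccontr)
      assume "\<not> ?thesis"
      then have high: "x t $ i > w $ i - e" if "t \<ge> T" for t using that by force
      have "x t $ i + \<eta> * (t - T) \<le> x T $ i" if "t \<ge> T" for t
      proof (rule le_of_derivative_nonpos_above[OF _ _ _ that])
        fix t assume "t \<ge> T"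
        then show "((\<lambda>t. x t $ i + \<eta> * (t - T)) has_vector_derivative V t + \<eta>) (at t within {T..})"
          by (intro has_vector_derivative_add der T)
            (auto intro!: derivative_eq_intros simp flip: has_real_derivative_iff_has_vector_derivative)
      qed (use decay high in force)+
      \<comment> \<open>At this time the linear estimate forces
        \<open>x s $ i \<le> - 1\<close>.\<close>
      moreover define s where "s = T + (x T $ i + 1) / \<eta>"
      moreover have "0 \<le> x T $ i" using xb[of T] T \<tau> by (simp add: less_eq_vec_def)
      then have s: "s \<ge> T" using \<eta> by (simp add: s_def)
      ultimately have "x s $ i + \<eta> * (s - T) \<le> x T $ i" by blast
      moreover have "\<eta> * (s - T) = x T $ i + 1" using \<eta> by (simp add: s_def)
      moreover have "0 \<le> x s $ i" using xb[of s] s T \<tau> by (simp add: less_eq_vec_def)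
      ultimately show False by simp
    qed
    then obtain a where a: "a \<ge> T" "x a $ i \<le> w $ i - e" by blast
    \<comment> \<open>Above this level the component cannot increase, so once below it stays below.
      The level is then an eventual upper bound smaller than the infimum
      \<open>w $ i\<close>.\<close>
    have "x t $ i \<le> w $ i - e" if "t \<ge> a" for t
    proof (rule le_of_derivative_nonpos_above[OF der a(2) _ that])
      fix t assume "t \<ge> a" "w $ i - e < x t $ i"
      then show "V t \<le> 0" using decay[of t] a \<eta> by simp
    qed (use a T in auto)
    then have "w $ i - e \<in> C i"
      unfolding C_def by (auto intro: eventually_at_top_linorderI)
    then have "w $ i \<le> w $ i - e" using cInf_lower[OF _ bdd] by (simp add: w_def)
    with e show False by simp
  qed
  have "((\<lambda>t. x t $ i) \<longlongrightarrow> 0) at_top" for i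
  proof (rule tendstoI)
    fix e :: real assume "e > 0"
    then have "eventually (\<lambda>t. x t $ i \<le> e / 2) at_top"
      using above[of "e / 2" i] \<open>w = 0\<close> by simp
    with ev0[of i] show "eventually (\<lambda>t. dist (x t $ i) 0 < e) at_top"
      by eventually_elim (use \<open>e > 0\<close> in auto)
  qed
  then show ?thesis by (intro vec_tendstoI) simp
qed

end

section \<open>Existence, stability and attractivity from invariant boxes\<close>

theorem theorem1:
  fixes f g :: "real ^ 'n \<Rightarrow> real ^ 'n" and D :: "(real ^ 'n) set" and \<alpha> :: real
  assumes "open D" and "nonneg_orthant \<subseteq> D"
    and "C1_on D f" and "C1_on D g"
    and "f 0 + g 0 = 0"
    and "\<forall>x\<in>nonneg_orthant. g x \<ge> 0"
    and "\<forall>i. \<forall>x\<in>nonneg_orthant. x $ i = 0 \<longrightarrow> f x $ i \<ge> 0"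
    and "\<alpha> > 0" and "subhomogeneous \<alpha> f" and "subhomogeneous \<alpha> g"
    and "\<forall>w\<in>nonneg_orthant - {0}. \<exists>i.
           Sup ((\<lambda>y. g y $ i) ` {y. 0 \<le> y \<and> y \<le> w})
           < - Sup ((\<lambda>x. f x $ i) ` {x. 0 \<le> x \<and> x \<le> w \<and> x $ i = w $ i})"
  shows "\<forall>\<tau>\<ge>0. dde_GAS f g \<tau>"
proof (intro allI impI)
  fix \<tau> :: real assume \<tau>: "\<tau> \<ge> 0"
  interpret positive_delay_system f g D
    using assms by unfold_locales auto
  have neg: "\<exists>i. growth i w < 0" if w: "0 \<le> w" "w \<noteq> 0" for w
  proof -
    obtain i where "box_sup g i w < - face_sup f i w"
      using bspec[OF assms(11), of w] w by (auto simp: face_sup_def box_sup_def nonneg_orthant_eq)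
    then have "growth i w < 0" by (simp add: growth_def)
    then show ?thesis by blast
  qed
  \<comment> \<open>The size \<open>r\<close> stays free: the point with \<open>r = 1\<close> is
    scaled up to dominate given initial data, while \<open>r = \<epsilon> / 2\<close> serves for
    stability.\<close>
  have v_ex: "\<exists>v. 0 \<le> v \<and> (\<Sum>i\<in>UNIV. v $ i) = r \<and> (\<forall>i. growth i v < 0) \<and> (\<forall>i. 0 < v $ i)"
    if "r > 0" for r
  proof (rule exists_common_negative_point[of growth r])
    show "continuous_on nonneg_orthant (growth i)" for i
      unfolding growth_def
      by (intro continuous_intros continuous_on_face_sup continuous_on_box_sup cont_f cont_g)
  qed (use growth_nonneg_boundary neg that in auto)
  have barrier: "\<exists>b. 0 \<le> b \<and> (\<forall>i. growth i b \<le> 0) \<and> (\<forall>s\<in>{-\<tau>..0}. \<phi> s \<le> b)"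
    if \<phi>: "\<phi> \<in> init_space \<tau>" for \<phi> :: "real \<Rightarrow> real ^ 'n"
  proof -
    obtain v :: "real ^ 'n" where v: "0 \<le> v" "\<And>i. growth i v < 0" "\<And>i. 0 < v $ i"
      using v_ex[of 1] by auto
    have "bounded (\<phi> ` {-\<tau>..0})"
      using \<phi> by (intro compact_imp_bounded compact_continuous_image) (auto simp: init_space_def)
    then obtain K where K: "\<And>s. s \<in> {-\<tau>..0} \<Longrightarrow> norm (\<phi> s) \<le> K"
      unfolding bounded_iff by blast
    \<comment> \<open>Large enough that \<open>c * v $ i \<ge> K\<close> for every \<open>i\<close>;
      inserting 1 gives the \<open>c \<ge> 1\<close> on which subhomogeneity relies.\<close>
    define c where "c = Max (insert 1 (range (\<lambda>i. K / v $ i)))"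
    have c: "c \<ge> 1" and cK: "K / v $ i \<le> c" for i
      unfolding c_def by (rule Max_ge; blast intro: finite_insert[THEN iffD2] finite)+
    have "growth i (c *\<^sub>R v) \<le> 0" for i
    proof -
      have "growth i (c *\<^sub>R v) \<le> c powr \<alpha> * growth i v"
        using face_sup_scaleR_le[OF cont_f assms(9) c v(1), of i]
          box_sup_scaleR_le[OF cont_g assms(10) c v(1), of i]
        by (simp add: growth_def distrib_left)
      also have "\<dots> \<le> 0" using v(2)[of i] by (simp add: mult_nonneg_nonpos)
      finally show ?thesis .
    qed
    moreover have "\<phi> s \<le> c *\<^sub>R v" if "s \<in> {-\<tau>..0}" for s
    proof -
      have "\<phi> s $ i \<le> c * v $ i" for i
        using K[OF that] component_le_norm_cart[of "\<phi> s" i] cK[of i] v(3)[of i] by (simp add: field_simps)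
      then show ?thesis by (simp add: less_eq_vec_def)
    qed
    moreover have "0 \<le> c *\<^sub>R v" using v(1) c by (simp add: less_eq_vec_def)
    ultimately show ?thesis by blast
  qed
  show "dde_GAS f g \<tau>"
    unfolding dde_GAS_def
  proof (intro conjI ballI allI impI)
    fix \<phi> :: "real \<Rightarrow> real ^ 'n" assume \<phi>: "\<phi> \<in> init_space \<tau>"
    obtain b where b: "0 \<le> b" "\<And>i. growth i b \<le> 0" "\<And>s. s \<in> {-\<tau>..0} \<Longrightarrow> \<phi> s \<le> b"
      using barrier[OF \<phi>] by blast
    show "\<exists>x. dde_solution f g \<tau> \<phi> x" using exists_bounded_solution[OF b(1,2) \<tau> \<phi> b(3)] by blast
    fix x assume x: "dde_solution f g \<tau> \<phi> x"
    show "(x \<longlongrightarrow> 0) at_top"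
      using dde_solution_tendsto_0[OF neg \<tau> x] dde_solution_bounded[OF b(1,2) \<tau> \<phi> b(3) x] by blast
  next
    fix \<epsilon> :: real assume \<epsilon>: "\<epsilon> > 0"
    \<comment> \<open>The norm is at most the sum of the absolute coordinates, so
      \<open>{0..v}\<close> lies in the open ball of radius \<open>\<epsilon>\<close>.\<close>
    obtain v :: "real ^ 'n" where v: "0 \<le> v" "(\<Sum>i\<in>UNIV. v $ i) = \<epsilon> / 2" "\<And>i. growth i v < 0" "\<And>i. 0 < v $ i"
      using v_ex[of "\<epsilon> / 2"] \<epsilon> by auto
    \<comment> \<open>The smallest coordinate of \<open>v\<close>: initial values of norm below it
      lie below \<open>v\<close>.\<close>
    define \<delta> where "\<delta> = Min (range (\<lambda>i. v $ i))"
    have \<delta>: "\<delta> > 0" "\<delta> \<le> v $ i" for i using v(4) by (auto simp: \<delta>_def)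
    show "\<exists>\<delta>>0. \<forall>\<phi>\<in>init_space \<tau>. \<forall>x. (\<forall>s\<in>{-\<tau>..0}. norm (\<phi> s) < \<delta>) \<and> dde_solution f g \<tau> \<phi> x
         \<longrightarrow> (\<forall>t\<ge>0. norm (x t) < \<epsilon>)"
    proof (intro exI[of _ \<delta>] conjI ballI allI impI \<delta>(1))
      fix \<phi> x and t :: real
      assume \<phi>: "\<phi> \<in> init_space \<tau>"
        and *: "(\<forall>s\<in>{-\<tau>..0}. norm (\<phi> s) < \<delta>) \<and> dde_solution f g \<tau> \<phi> x" and t: "0 \<le> t"
      have "\<phi> s \<le> v" if "s \<in> {-\<tau>..0}" for s
      proof -
        have "\<phi> s $ i \<le> v $ i" for i
          using bspec[OF conjunct1[OF *] that] component_le_norm_cart[of "\<phi> s" i] \<delta>(2)[of i] by simp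
        then show ?thesis by (simp add: less_eq_vec_def)
      qed
      then have xt: "x t \<in> {0..v}"
        using * t \<tau> v(3) by (intro dde_solution_bounded[OF v(1) _ \<tau> \<phi>]) (auto simp: less_imp_le)
      have "norm (x t) \<le> (\<Sum>i\<in>UNIV. \<bar>x t $ i\<bar>)" by (rule norm_le_l1_cart)
      also have "\<dots> \<le> (\<Sum>i\<in>UNIV. v $ i)" using xt by (intro sum_mono) (auto simp: less_eq_vec_def)
      also have "\<dots> < \<epsilon>" using v(2) \<epsilon> by simp
      finally show "norm (x t) < \<epsilon>" .
    qed
  qed
qed

end
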